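(* Let $[c_0,\ldots,c_n]$ be a finite simple continued fraction with integer partial denominators, containing a contiguous subsequence $c_m,c_{m+1},\ldots,c_{m+2k}$ (with $k\ge 1$, $0\le m$, $m+2k\le n$) such that (1) the integers $c_m,c_{m+1},\ldots,c_{m+2k}$ are nonzero and all have the same sign $\delta\in\{-1,1\}$; (2) $c_m$ and $c_{m+2k}$ are odd; (3) $c_{m+2i}$ is even for $1\le i\le k-1$. Then the continued fraction obtained from $[c_0,\ldots,c_n]$ by the following transformation has the same evaluation: (1) replace $c_m$ with $c_m+\delta$ and $c_{m+2k}$ with $c_{m+2k}+\delta$; (2) for each $i\in\{1,\ldots,k-1\}$ replace $c_{m+2i}$ with $c_{m+2i}+2\delta$; (3) for each $i\in\{1,\ldots,k\}$ replace $c_{m+2i-1}$ with $|c_{m+2i-1}|-1$ copies of $2$ (so $c_{m+2i-1}$ is simply removed if $|c_{m+2i-1}|=1$); (4) keep the sign of the new entry $c_m+\delta$, keep the absolute values of all subsequent new entries up to and including the changed copy of $c_{m+2k}$, and choose their signs so that the signs alternate along this transformed block; (5) for each $j>m+2k$ replace $c_j$ with $(-1)^{|c_{m+1}|+|c_{m+3}|+\cdots+|c_{m+2k-1}|}\cdot c_j$. The entries $c_j$ with $j<m$ are left unchanged.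
   Context: For integers $c_0,\ldots,c_n$, $[c_0,\ldots,c_n]$ denotes the finite simple continued fraction $c_0+\cfrac{1}{c_1+\cfrac{1}{\ddots+\cfrac{1}{c_n}}}$ with partial denominators $c_i$. Its evaluation is $p/q\in\mathbb{Q}\cup\{\infty\}$, where $(p,q)^T=M(c_0)M(c_1)\cdots M(c_n)\,(1,0)^T$ (column vectors) with $M(c)=\begin{pmatrix}c&1\\1&0\end{pmatrix}$, and $p/0=\infty$ for $p\ne0$ (the vector is never zero since $\det M(c)=-1$). *)

theory Defs
  imports "HOL-Analysis.Analysis"
begin

text \<open>The projective line over the rationals, as the rationals with one point at infinity.\<close>

datatype proj_rat = Fin rat | Infty

definition cf_matrix :: "int \<Rightarrow> int^2^2" where
  "cf_matrix c = vector [vector [c, 1], vector [1, 0]]"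

text \<open>The vector \<open>M(c_0) \<cdots> M(c_n) (1, 0)\<close> of numerator and denominator.\<close>

definition cf_vector :: "int list \<Rightarrow> int^2" where
  "cf_vector cs = foldr (\<lambda>c A. cf_matrix c ** A) cs (mat 1) *v vector [1, 0]"

text \<open>Every \<^term>\<open>cf_matrix c\<close> has determinant \<open>-1\<close>, so \<^term>\<open>cf_vector cs\<close> is never zero
  and a zero denominator does mean the point at infinity.\<close>

definition cf_eval :: "int list \<Rightarrow> proj_rat" where
  "cf_eval cs =
     (let v = cf_vector cs
      in if v $ 2 = 0 then Infty else Fin (of_int (v $ 1) / of_int (v $ 2)))"

text \<open>Keep the sign of the first entry and all absolute values, and make the signs alternate.\<close>

definition alternate_signs :: "int list \<Rightarrow> int list" where
  "alternate_signs xs = map (\<lambda>j. (-1) ^ j * sgn (hd xs) * \<bar>xs ! j\<bar>) [0..<length xs]"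

text \<open>The replacement of the block \<open>c_m, \<dots>, c_{m+2k}\<close> before its signs are adjusted: the
  \<open>i\<close>-th segment is the run of 2s replacing \<open>c_{m+2i-1}\<close> followed by the changed \<open>c_{m+2i}\<close>.\<close>

definition cf_block :: "int \<Rightarrow> nat \<Rightarrow> nat \<Rightarrow> int list \<Rightarrow> int list" where
  "cf_block \<delta> m k cs =
     (cs ! m + \<delta>) #
     concat (map (\<lambda>i. replicate (nat (\<bar>cs ! (m + 2 * i - 1)\<bar> - 1)) 2 @
                      [if i < k then cs ! (m + 2 * i) + 2 * \<delta> else cs ! (m + 2 * k) + \<delta>])
                 [1..<k + 1])"

definition cf_transform :: "int \<Rightarrow> nat \<Rightarrow> nat \<Rightarrow> int list \<Rightarrow> int list" where
  "cf_transform \<delta> m k cs =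
     take m cs @
     alternate_signs (cf_block \<delta> m k cs) @
     map (\<lambda>c. (-1) ^ (\<Sum>i=1..k. nat \<bar>cs ! (m + 2 * i - 1)\<bar>) * c) (drop (m + 2 * k + 1) cs)"

end

theory Submission
  imports Defs
begin

text \<open>Write \<open>x\<close> for the tail of the expansion, so that \<open>c + 1/(b + 1/x)\<close> with \<open>b > 0\<close> equals the
  negative continued fraction \<open>(c + 1) - 1/(2 - 1/(\<dots> - 1/(2 - 1/(x + 1))))\<close> with \<open>b - 1\<close> twos.
  Applying this at every second place of the block turns it into a negative continued fraction,
  each inner even-indexed entry receiving one increment from either side. A negative continued
  fraction is an ordinary one with alternating signs, and a global sign change of the partial
  denominators only changes the sign of the value.\<close>

text \<open>Values are carried as pairs of numerator and denominator, so a tail with value infinity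
  needs no separate case.\<close>

fun cf_step :: "int \<Rightarrow> int \<times> int \<Rightarrow> int \<times> int" where
  "cf_step c (p, q) = (c * p + q, p)"

fun neg_step :: "int \<Rightarrow> int \<times> int \<Rightarrow> int \<times> int" where
  "neg_step c (p, q) = (c * p - q, p)"

fun scale_snd :: "int \<Rightarrow> int \<times> int \<Rightarrow> int \<times> int" where
  "scale_snd s (p, q) = (p, s * q)"

text \<open>Moving a sign across a step reproduces a pair only up to a common factor -1, which
  \<open>ratio\<close> does not see.\<close>

definition sign_eq :: "int \<times> int \<Rightarrow> int \<times> int \<Rightarrow> bool" (infix \<open>\<simeq>\<close> 50) where
  "v \<simeq> w \<longleftrightarrow> v = w \<or> v = - w"

definition ratio :: "int \<times> int \<Rightarrow> proj_rat" where
  "ratio v = (if snd v = 0 then Infty else Fin (of_int (fst v) / of_int (snd v)))"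

text \<open>Recursive counterpart of \<open>alternate_signs\<close>. The leading sign is a parameter
  because the tail of an alternating list starts with the opposite sign.\<close>

fun signs_from :: "int \<Rightarrow> int list \<Rightarrow> int list" where
  "signs_from s [] = []"
| "signs_from s (x # xs) = s * \<bar>x\<bar> # signs_from (- s) xs"

lemma sign_eq_refl: "v \<simeq> v"
  by (simp add: sign_eq_def)

lemma sign_eq_sym: "v \<simeq> w \<Longrightarrow> w \<simeq> v"
  by (auto simp: sign_eq_def)

lemma sign_eq_trans [trans]: "u \<simeq> v \<Longrightarrow> v \<simeq> w \<Longrightarrow> u \<simeq> w"
  by (auto simp: sign_eq_def)

lemma cf_step_sign_eq: "v \<simeq> w \<Longrightarrow> cf_step c v \<simeq> cf_step c w"
  by (cases v; cases w) (auto simp: sign_eq_def)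

lemma foldr_cf_step_sign_eq: "v \<simeq> w \<Longrightarrow> foldr cf_step cs v \<simeq> foldr cf_step cs w"
  by (induction cs) (auto intro: cf_step_sign_eq)

lemma ratio_sign_eq: "v \<simeq> w \<Longrightarrow> ratio v = ratio w"
  by (cases v; cases w) (auto simp: sign_eq_def ratio_def)

lemma scale_snd_scale_snd: "scale_snd s (scale_snd t v) = scale_snd (s * t) v"
  by (cases v) simp

lemma scale_snd_1 [simp]: "scale_snd 1 v = v"
  by (cases v) simp

lemma cf_vector_eq_foldr:
  "cf_vector cs $ 1 = fst (foldr cf_step cs (1, 0)) \<and>
   cf_vector cs $ 2 = snd (foldr cf_step cs (1, 0))"
proof (induction cs)
  case Nil
  show ?case
    by (simp add: cf_vector_def)
next
  case (Cons c cs)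
  have "cf_vector (c # cs) = cf_matrix c *v cf_vector cs"
    by (simp add: cf_vector_def matrix_vector_mul_assoc)
  then show ?case
    using Cons by (cases "foldr cf_step cs (1, 0)")
      (simp add: cf_matrix_def matrix_vector_mult_def sum_2)
qed

lemma cf_eval_eq_ratio: "cf_eval cs = ratio (foldr cf_step cs (1, 0))"
  by (simp add: cf_eval_def ratio_def cf_vector_eq_foldr Let_def)

text \<open>On values this is s*c + 1/(s*x) = s*(c + 1/x), which holds because 1/s = s.\<close>

lemma cf_step_scale_snd:
  assumes "s \<in> {-1, 1}"
  shows "cf_step (s * c) (scale_snd s v) \<simeq> scale_snd s (cf_step c v)"
  using assms by (cases v) (auto simp: sign_eq_def)

lemma foldr_cf_step_scale_snd:
  assumes "s \<in> {-1, 1}"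
  shows "foldr cf_step (map ((*) s) cs) (scale_snd s v) \<simeq> scale_snd s (foldr cf_step cs v)"
proof (induction cs)
  case (Cons c cs)
  have "foldr cf_step (map ((*) s) (c # cs)) (scale_snd s v)
      \<simeq> cf_step (s * c) (scale_snd s (foldr cf_step cs v))"
    using cf_step_sign_eq[OF Cons] by simp
  also have "\<dots> \<simeq> scale_snd s (foldr cf_step (c # cs) v)"
    using cf_step_scale_snd[OF assms] by simp
  finally show ?case .
qed (simp add: sign_eq_refl)

text \<open>On values: s*c + 1/(-s*x) = s*(c - 1/x).\<close>

lemma cf_step_eq_neg_step:
  assumes "s \<in> {-1, 1}"
  shows "cf_step (s * c) (scale_snd (- s) v) \<simeq> scale_snd s (neg_step c v)"
  using assms by (cases v) (auto simp: sign_eq_def)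

text \<open>Each entry flips the sign that its tail must carry, so the innermost pair carries
  \<open>s * (-1) ^ length xs\<close>.\<close>

lemma foldr_signs_from:
  assumes "s \<in> {-1, 1}"
  shows "foldr cf_step (signs_from s xs) (scale_snd (s * (-1) ^ length xs) v)
    \<simeq> scale_snd s (foldr neg_step (map abs xs) v)"
  using assms
proof (induction xs arbitrary: s)
  case (Cons x xs)
  have "foldr cf_step (signs_from (- s) xs) (scale_snd (- s * (-1) ^ length xs) v)
      \<simeq> scale_snd (- s) (foldr neg_step (map abs xs) v)"
    using Cons.prems by (intro Cons.IH) auto
  then have "foldr cf_step (signs_from s (x # xs)) (scale_snd (s * (-1) ^ length (x # xs)) v)
      \<simeq> cf_step (s * \<bar>x\<bar>) (scale_snd (- s) (foldr neg_step (map abs xs) v))"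
    using cf_step_sign_eq by simp
  also have "\<dots> \<simeq> scale_snd s (foldr neg_step (map abs (x # xs)) v)"
    using cf_step_eq_neg_step[OF Cons.prems] by simp
  finally show ?case .
qed (simp add: sign_eq_refl)

lemma map_nth_eq_signs_from:
  "map (\<lambda>j. (-1) ^ j * s * \<bar>xs ! j\<bar>) [0..<length xs] = signs_from s xs"
proof (induction xs arbitrary: s)
  case (Cons x xs)
  have "map (\<lambda>j. (-1) ^ j * s * \<bar>(x # xs) ! j\<bar>) [0..<length (x # xs)]
      = s * \<bar>x\<bar> # map (\<lambda>j. (-1) ^ j * (- s) * \<bar>xs ! j\<bar>) [0..<length xs]"
    by (simp add: upt_conv_Cons map_Suc_upt[symmetric] del: upt_Suc)
  then show ?case
    using Cons[of "- s"] by simp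
qed simp

lemma alternate_signs_eq_signs_from: "alternate_signs xs = signs_from (sgn (hd xs)) xs"
  unfolding alternate_signs_def by (rule map_nth_eq_signs_from)

text \<open>The matrix of \<open>neg_step 2\<close> is I + N with N = (1 -1; 1 -1) and N^2 = 0, so
  its \<open>b\<close>-th power is I + bN.\<close>

lemma neg_step_2_pow:
  "foldr neg_step (replicate b 2) (p, q)
    = ((int b + 1) * p - int b * q, int b * p - (int b - 1) * q)"
  by (induction b) (auto simp: algebra_simps)

text \<open>The twos send \<open>(p + q, q)\<close> to \<open>(b * p + q, (b - 1) * p + q)\<close>.
  Here the first entry minus the second is \<open>p\<close>, which is how the increment of
  \<open>x\<close> is absorbed.\<close>

lemma neg_step_twos:
  assumes "b > 0"
  shows "neg_step (x + 1) (foldr neg_step (replicate (b - 1) 2) (p + q, q))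
    = cf_step x (cf_step (int b) (p, q))"
  using assms by (cases b) (auto simp: neg_step_2_pow algebra_simps simp del: foldr_replicate)

text \<open>What follows the block remains an ordinary continued fraction: negating \<open>w\<close>
  turns the last -1/w into +1/w. The entry \<open>x\<close> is arbitrary because each
  \<open>e j\<close> takes its place in turn.\<close>

lemma foldr_neg_step_block:
  assumes "1 \<le> j" and "j \<le> k" and "\<And>i. i \<in> {1..k} \<Longrightarrow> b i > 0"
  shows "foldr neg_step
      ((x + 1) # concat (map (\<lambda>i. replicate (b i - 1) 2 @ [if i < k then e i + 2 else e k + 1])
        [j..<k + 1])) (scale_snd (-1) w)
    = foldr cf_step (x # concat (map (\<lambda>i. [int (b i), e i]) [j..<k + 1])) w"
  using assms(2,1)
proof (induction j arbitrary: x rule: inc_induct)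
  case base
  \<comment> \<open>The tail behind \<open>b k\<close> is \<open>cf_step (e k) w\<close>, and
    raising \<open>e k\<close> by one adds its second entry to its first.\<close>
  show ?case
    using neg_step_twos[of "b k" x "e k * fst w + snd w" "fst w"] assms(3)[of k] base
    by (cases w) (simp add: algebra_simps del: foldr_replicate)
next
  case (step j)
  let ?g = "\<lambda>i. replicate (b i - 1) 2 @ [if i < k then e i + 2 else e k + 1]"
  let ?h = "\<lambda>i. [int (b i), e i]"
  obtain p q where pq: "foldr neg_step (concat (map ?g [Suc j..<k + 1])) (scale_snd (-1) w) = (p, q)"
    by fastforce
  \<comment> \<open>With \<open>e j\<close> as leading entry, the induction hypothesis accounts for
    one of its two increments.\<close>
  have IH: "neg_step (e j + 1) (p, q)
      = cf_step (e j) (foldr cf_step (concat (map ?h [Suc j..<k + 1])) w)"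
    using step.IH[of "e j"] pq by simp
  have upt: "[j..<k + 1] = j # [Suc j..<k + 1]"
    using step.hyps by (simp add: upt_conv_Cons)
  have "foldr neg_step ((x + 1) # concat (map ?g [j..<k + 1])) (scale_snd (-1) w)
      = neg_step (x + 1) (foldr neg_step (replicate (b j - 1) 2) (neg_step (e j + 2) (p, q)))"
    unfolding upt using step.hyps pq by (simp del: upt_Suc foldr_replicate)
  \<comment> \<open>The other increment produces the shape \<open>(p + q, q)\<close> that
    \<open>neg_step_twos\<close> expects.\<close>
  also have "neg_step (e j + 2) (p, q) = ((e j + 1) * p - q + p, p)"
    by (simp add: algebra_simps)
  also have "neg_step (x + 1) (foldr neg_step (replicate (b j - 1) 2) \<dots>)
      = cf_step x (cf_step (int (b j)) (neg_step (e j + 1) (p, q)))"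
    using neg_step_twos[of "b j" x "(e j + 1) * p - q" p] assms(3)[of j] step.hyps step.prems by simp
  also have "\<dots> = foldr cf_step (x # concat (map ?h [j..<k + 1])) w"
    unfolding upt IH by simp
  finally show ?case .
qed

lemma take_pairs:
  assumes "m + 2 * k < length cs"
  shows "take (2 * k + 1) (drop m cs)
    = cs ! m # concat (map (\<lambda>i. [cs ! (m + 2 * i - 1), cs ! (m + 2 * i)]) [1..<k + 1])"
  using assms
proof (induction k)
  case 0
  then show ?case
    by (simp add: take_Suc_conv_app_nth)
next
  case (Suc k)
  have "take (2 * Suc k + 1) (drop m cs)
      = take (2 * k + 1) (drop m cs) @ [cs ! (m + (2 * k + 1)), cs ! (m + (2 * k + 2))]"
    using Suc.prems by (simp add: take_Suc_conv_app_nth)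
  then show ?case
    using Suc by simp
qed

lemma split_block:
  assumes "m + 2 * k < length cs"
  shows "cs = take m cs @ (cs ! m #
      concat (map (\<lambda>i. [cs ! (m + 2 * i - 1), cs ! (m + 2 * i)]) [1..<k + 1])) @
      drop (m + 2 * k + 1) cs"
proof -
  have "cs = take m cs @ take (2 * k + 1) (drop m cs) @ drop (2 * k + 1) (drop m cs)"
    by (simp only: append_take_drop_id)
  then show ?thesis
    unfolding take_pairs[OF assms] by (simp add: ac_simps)
qed

text \<open>A segment consists of \<bar>c\<bar> - 1 twos and one more entry, so the sign in front of
  the final tail records the parity of the block length. At c = 0 truncation by \<open>nat\<close>
  would break the count.\<close>

lemma length_cf_block:
  assumes "\<And>i. i \<in> {1..k} \<Longrightarrow> cs ! (m + 2 * i - 1) \<noteq> 0"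
  shows "length (cf_block \<delta> m k cs) = Suc (\<Sum>i=1..k. nat \<bar>cs ! (m + 2 * i - 1)\<bar>)"
proof -
  have "(\<Sum>i=1..k. nat (\<bar>cs ! (m + 2 * i - 1)\<bar> - 1) + 1) = (\<Sum>i=1..k. nat \<bar>cs ! (m + 2 * i - 1)\<bar>)"
  proof (rule sum.cong)
    fix i assume "i \<in> {1..k}"
    then show "nat (\<bar>cs ! (m + 2 * i - 1)\<bar> - 1) + 1 = nat \<bar>cs ! (m + 2 * i - 1)\<bar>"
      using assms[of i] by linarith
  qed simp
  then show ?thesis
    by (simp add: cf_block_def length_concat o_def interv_sum_list_conv_sum_set_nat
        atLeastLessThanSuc_atLeastAtMost del: upt_Suc)
qed

theorem proposition3p2:
  fixes cs :: "int list" and n m k :: nat and \<delta> :: int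
  assumes "length cs = n + 1"
    and "k \<ge> 1"
    and "m + 2 * k \<le> n"
    and "\<delta> \<in> {-1, 1}"
    and "\<forall>j\<in>{m..m + 2 * k}. cs ! j \<noteq> 0 \<and> sgn (cs ! j) = \<delta>"
    and "odd (cs ! m)"
    and "odd (cs ! (m + 2 * k))"
    and "\<forall>i. 1 \<le> i \<and> i \<le> k - 1 \<longrightarrow> even (cs ! (m + 2 * i))"
  shows "cf_eval (cf_transform \<delta> m k cs) = cf_eval cs"
proof -
  define b where "b i = nat \<bar>cs ! (m + 2 * i - 1)\<bar>" for i
  define e where "e i = \<bar>cs ! (m + 2 * i)\<bar>" for i
  define \<sigma> :: int where "\<sigma> = (-1) ^ (\<Sum>i=1..k. b i)"
  define rest where "rest = drop (m + 2 * k + 1) cs"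
  define w where "w = foldr cf_step rest (1, 0)"
  define xs where "xs = cf_block \<delta> m k cs"
  define block where
    "block = cs ! m # concat (map (\<lambda>i. [cs ! (m + 2 * i - 1), cs ! (m + 2 * i)]) [1..<k + 1])"
  define abs_block where
    "abs_block = \<bar>cs ! m\<bar> # concat (map (\<lambda>i. [int (b i), e i]) [1..<k + 1])"
  have \<delta>\<delta>: "\<delta> * \<delta> = 1"
    using assms(4) by auto
  have entry: "cs ! j \<noteq> 0" "cs ! j = \<delta> * \<bar>cs ! j\<bar>" if "j \<in> {m..m + 2 * k}" for j
    using assms(5) that mult_sgn_abs[of "cs ! j"] by (auto simp: mult.commute)
  have odd_pos: "m + 2 * i - 1 \<in> {m..m + 2 * k}" if "i \<in> {1..k}" for i
    using that by auto
  have b_pos: "b i > 0" if "i \<in> {1..k}" for i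
    using entry(1)[OF odd_pos[OF that]] by (simp add: b_def)
  have block_eq: "block = map ((*) \<delta>) abs_block"
  proof -
    have "[cs ! (m + 2 * i - 1), cs ! (m + 2 * i)] = map ((*) \<delta>) [int (b i), e i]"
      if "i \<in> set [1..<k + 1]" for i
      using entry(2)[OF odd_pos, of i] entry(2)[of "m + 2 * i"] that by (auto simp: b_def e_def)
    then have "concat (map (\<lambda>i. [cs ! (m + 2 * i - 1), cs ! (m + 2 * i)]) [1..<k + 1])
        = map ((*) \<delta>) (concat (map (\<lambda>i. [int (b i), e i]) [1..<k + 1]))"
      unfolding map_concat map_map o_def by (intro arg_cong[where f = concat] map_cong) auto
    then show ?thesis
      using entry(2)[of m] by (simp add: block_def abs_block_def)
  qed
  \<comment> \<open>The entries have sign \<delta>, so adding a nonnegative multiple of \<delta>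
    moves them away from zero.\<close>
  have abs_shift: "\<bar>cs ! j + t * \<delta>\<bar> = \<bar>cs ! j\<bar> + t" if "j \<in> {m..m + 2 * k}" "t \<ge> 0" for j t
    using entry(2)[OF that(1)] that(2) assms(4) by auto
  have abs_xs: "map abs xs = (\<bar>cs ! m\<bar> + 1) #
      concat (map (\<lambda>i. replicate (b i - 1) 2 @ [if i < k then e i + 2 else e k + 1]) [1..<k + 1])"
  proof -
    have "map abs (replicate (nat (\<bar>cs ! (m + 2 * i - 1)\<bar> - 1)) 2 @
          [if i < k then cs ! (m + 2 * i) + 2 * \<delta> else cs ! (m + 2 * k) + \<delta>])
        = replicate (b i - 1) 2 @ [if i < k then e i + 2 else e k + 1]"
      if "i \<in> set [1..<k + 1]" for i
      using abs_shift[of "m + 2 * i" 2] abs_shift[of "m + 2 * k" 1] that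
      by (auto simp: b_def e_def nat_diff_distrib')
    then have "map abs (concat (map (\<lambda>i. replicate (nat (\<bar>cs ! (m + 2 * i - 1)\<bar> - 1)) 2 @
          [if i < k then cs ! (m + 2 * i) + 2 * \<delta> else cs ! (m + 2 * k) + \<delta>]) [1..<k + 1]))
        = concat (map (\<lambda>i. replicate (b i - 1) 2 @ [if i < k then e i + 2 else e k + 1]) [1..<k + 1])"
      unfolding map_concat map_map o_def by (intro arg_cong[where f = concat] map_cong) auto
    then show ?thesis
      unfolding xs_def cf_block_def list.map using abs_shift[of m 1] by simp
  qed
  have sgn_hd: "sgn (hd xs) = \<delta>"
    using assms(4) entry[of m] by (auto simp: xs_def cf_block_def sgn_if)
  \<comment> \<open>The block is one entry longer than the exponent in \<sigma>; the resulting minus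
    sign is the \<open>scale_snd (-1)\<close> of \<open>foldr_neg_step_block\<close>.\<close>
  have len_xs: "\<delta> * (-1) ^ length xs = - \<delta> * \<sigma>"
    using length_cf_block[OF entry(1)[OF odd_pos], of k \<delta>] by (simp add: xs_def \<sigma>_def b_def)
  have "foldr cf_step (signs_from \<delta> xs) (foldr cf_step (map ((*) \<sigma>) rest) (1, 0))
      \<simeq> foldr cf_step (signs_from \<delta> xs) (scale_snd \<sigma> w)"
  proof (rule foldr_cf_step_sign_eq)
    have "\<sigma> \<in> {-1, 1}"
      unfolding \<sigma>_def by (metis insertCI neg_one_even_power neg_one_odd_power)
    from foldr_cf_step_scale_snd[OF this, of rest "(1, 0)"]
    show "foldr cf_step (map ((*) \<sigma>) rest) (1, 0) \<simeq> scale_snd \<sigma> w"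
      by (simp add: w_def)
  qed
  \<comment> \<open>Of the two cancelling factors \<delta>, one completes the sign required by
    \<open>foldr_signs_from\<close>; the other stays on \<open>w\<close> until
    \<open>abs_block\<close> is turned back into \<open>block\<close>.\<close>
  also have "scale_snd \<sigma> w
      = scale_snd (\<delta> * (-1) ^ length xs) (scale_snd (-1) (scale_snd \<delta> w))"
    using \<delta>\<delta> by (simp add: scale_snd_scale_snd len_xs ac_simps flip: mult.assoc)
  also have "foldr cf_step (signs_from \<delta> xs) \<dots>
      \<simeq> scale_snd \<delta> (foldr neg_step (map abs xs) (scale_snd (-1) (scale_snd \<delta> w)))"
    by (rule foldr_signs_from[OF assms(4)])
  also have "foldr neg_step (map abs xs) (scale_snd (-1) (scale_snd \<delta> w))
      = foldr cf_step abs_block (scale_snd \<delta> w)"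
    unfolding abs_xs abs_block_def using assms(2) b_pos by (intro foldr_neg_step_block) auto
  also have "scale_snd \<delta> \<dots> \<simeq> foldr cf_step block (scale_snd \<delta> (scale_snd \<delta> w))"
    unfolding block_eq by (rule sign_eq_sym[OF foldr_cf_step_scale_snd[OF assms(4)]])
  also have "scale_snd \<delta> (scale_snd \<delta> w) = w"
    by (simp add: scale_snd_scale_snd \<delta>\<delta>)
  finally have "foldr cf_step (take m cs @ signs_from \<delta> xs @ map ((*) \<sigma>) rest) (1, 0)
      \<simeq> foldr cf_step (take m cs @ block @ rest) (1, 0)"
    by (simp add: foldr_cf_step_sign_eq w_def)
  moreover have "cf_transform \<delta> m k cs = take m cs @ signs_from \<delta> xs @ map ((*) \<sigma>) rest"
    unfolding cf_transform_def alternate_signs_eq_signs_from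
    using sgn_hd by (simp add: xs_def \<sigma>_def b_def rest_def)
  moreover have "cs = take m cs @ block @ rest"
    unfolding block_def rest_def using assms(1,3) by (intro split_block) simp
  ultimately show ?thesis
    unfolding cf_eval_eq_ratio by (metis ratio_sign_eq)
qed

end
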